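(* Let $G$ be a topological gyrogroup. Then $G$ is metrizable if and only if $G$ has an $\omega^{\omega}$-base and $G$ is Fréchet-Urysohn.
   Context: All topological spaces are assumed Hausdorff; $\mathbb{N}$ is the set of positive integers. A groupoid $(G,\oplus)$ (a set with a binary operation) is a gyrogroup if: (G1) there is a unique identity element $0\in G$ with $0\oplus a=a=a\oplus 0$ for all $a\in G$; (G2) for every $x\in G$ there is a unique inverse $\ominus x\in G$ with $\ominus x\oplus x=0=x\oplus(\ominus x)$; (G3) for all $x,y\in G$ there is an automorphism $\mathrm{gyr}[x,y]\in \mathrm{Aut}(G,\oplus)$ with $x\oplus(y\oplus z)=(x\oplus y)\oplus \mathrm{gyr}[x,y](z)$ for all $z\in G$; (G4) $\mathrm{gyr}[x\oplus y,y]=\mathrm{gyr}[x,y]$ for all $x,y\in G$. A topological gyrogroup is a gyrogroup $(G,\oplus)$ with a topology such that $\oplus:G\times G\to G$ is jointly continuous (product topology on $G\times G$) and $x\mapsto\ominus x$ is continuous. $\mathbb{N}^{\mathbb{N}}$ is the set of functions $\mathbb{N}\to\mathbb{N}$ with the pointwise partial order: $f\le g$ iff $f(n)\le g(n)$ for all $n$. A space $X$ has an $\omega^{\omega}$-base if at each $x\in X$ there is a neighborhood base $\{U_{\alpha}(x):\alpha\in\mathbb{N}^{\mathbb{N}}\}$ at $x$ with $U_{\beta}(x)\subset U_{\alpha}(x)$ whenever $\alpha\le\beta$. A space $X$ is Fréchet-Urysohn if for every $A\subset X$ and every $x\in\overline{A}$ there is a sequence in $A$ converging to $x$. *)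

theory Defs
  imports "HOL-Analysis.Analysis" "HOL-Algebra.Group"
begin

text \<open>
  A gyrogroup is carried by the monoid record of HOL-Algebra (no associativity is assumed):
  the operation is \<^term>\<open>mult G\<close>, the identity is \<^term>\<open>one G\<close>, and the inverse is
  \<^const>\<open>m_inv\<close>, which is well defined by the assumption \<open>inverse\<close>.
  Automorphisms are elements of \<^term>\<open>iso G G\<close>; since functions are unconstrained
  outside the carrier, equality of gyrations is equality on the carrier.
\<close>

locale gyrogroup =
  fixes G :: "('a, 'b) monoid_scheme" (structure)
  assumes closed: "\<lbrakk>x \<in> carrier G; y \<in> carrier G\<rbrakk> \<Longrightarrow> x \<otimes> y \<in> carrier G"
    and one_closed: "\<one> \<in> carrier G"
    and identity: "x \<in> carrier G \<Longrightarrow> \<one> \<otimes> x = x \<and> x \<otimes> \<one> = x"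
    and identity_unique:
      "\<lbrakk>e \<in> carrier G; \<forall>a\<in>carrier G. e \<otimes> a = a \<and> a \<otimes> e = a\<rbrakk> \<Longrightarrow> e = \<one>"
    and inverse: "x \<in> carrier G \<Longrightarrow> \<exists>!y. y \<in> carrier G \<and> y \<otimes> x = \<one> \<and> x \<otimes> y = \<one>"
    and gyration:
      "\<exists>gyr. (\<forall>x\<in>carrier G. \<forall>y\<in>carrier G. gyr x y \<in> iso G G \<and>
                (\<forall>z\<in>carrier G. x \<otimes> (y \<otimes> z) = (x \<otimes> y) \<otimes> gyr x y z)) \<and>
             (\<forall>x\<in>carrier G. \<forall>y\<in>carrier G. \<forall>z\<in>carrier G. gyr (x \<otimes> y) y z = gyr x y z)"

locale topological_gyrogroup = gyrogroup G
  for G :: "('a, 'b) monoid_scheme" (structure) +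
  fixes T :: "'a topology"
  assumes topspace_eq: "topspace T = carrier G"
    and continuous_mult: "continuous_map (prod_topology T T) T (\<lambda>(x, y). x \<otimes> y)"
    and continuous_inv: "continuous_map T T (\<lambda>x. inv x)"

text \<open>
  The sets of a neighbourhood base need not be open. The index set \<open>\<nat>\<^sup>\<nat>\<close> enters only as a
  partially ordered set, so it does not matter that \<^typ>\<open>nat\<close> contains \<open>0\<close>:
  \<^typ>\<open>nat\<close> is order isomorphic to the positive integers. The order \<open>\<le>\<close> on
  \<^typ>\<open>nat \<Rightarrow> nat\<close> is the pointwise one.
\<close>

definition has_omega_omega_base :: "'a topology \<Rightarrow> bool" where
  "has_omega_omega_base X \<longleftrightarrow>
     (\<forall>x\<in>topspace X. \<exists>U :: (nat \<Rightarrow> nat) \<Rightarrow> 'a set.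
        (\<forall>\<alpha>. U \<alpha> \<subseteq> topspace X \<and> (\<exists>V. openin X V \<and> x \<in> V \<and> V \<subseteq> U \<alpha>)) \<and>
        (\<forall>W. openin X W \<and> x \<in> W \<longrightarrow> (\<exists>\<alpha>. U \<alpha> \<subseteq> W)) \<and>
        (\<forall>\<alpha> \<beta>. \<alpha> \<le> \<beta> \<longrightarrow> U \<beta> \<subseteq> U \<alpha>))"

definition Frechet_Urysohn_space :: "'a topology \<Rightarrow> bool" where
  "Frechet_Urysohn_space X \<longleftrightarrow>
     (\<forall>A x. A \<subseteq> topspace X \<and> x \<in> X closure_of A \<longrightarrow>
        (\<exists>s :: nat \<Rightarrow> 'a. range s \<subseteq> A \<and> limitin X s x sequentially))"

end

theory Submission
  imports Defs
begin

text \<open>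
  Suppose that \<open>G\<close> is Frechet--Urysohn with an \<open>\<omega>\<^sup>\<omega>\<close>-base \<open>U\<close> at the identity \<open>\<one>\<close>. For each \<open>\<alpha>\<close>,
  some set \<open>\<Inter>{U \<beta> | \<beta>. \<beta> agrees with \<alpha> below k}\<close> is a neighbourhood of \<open>\<one>\<close>; these sets depend
  only on finite sequences, so \<open>G\<close> is first countable at \<open>\<one>\<close>.

  Left translates \<open>W n x = x \<otimes> U n\<close> of a countable base at \<open>\<one>\<close> need not come from a uniformity, but
  they satisfy Frink's local condition: if \<open>y \<otimes> v = x \<otimes> u\<close> with \<open>u\<close>, \<open>v\<close> near \<open>\<one>\<close>, then \<open>y\<close> is near
  \<open>x\<close> since right division is continuous, and so is \<open>y \<otimes> v'\<close> for \<open>v'\<close> near \<open>\<one>\<close>. Frink's condition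
  yields a countable base of entourages, and these yield a metric by summing along chains.
\<close>

section \<open>Metrization by chains\<close>

text \<open>A chain is a starting point together with the list of its later points. So every list is
  a chain, and its end is \<open>last (x # zs)\<close> even for the empty list.\<close>

fun chain_cost :: "('a \<Rightarrow> 'a \<Rightarrow> real) \<Rightarrow> 'a \<Rightarrow> 'a list \<Rightarrow> real" where
  "chain_cost w x [] = 0"
| "chain_cost w x (z # zs) = w x z + chain_cost w z zs"

lemma chain_cost_append:
  "chain_cost w x (as @ bs) = chain_cost w x as + chain_cost w (last (x # as)) bs"
  by (induction as arbitrary: x) auto

lemma chain_cost_nonneg:
  assumes "\<And>x y. 0 \<le> w x y"
  shows "0 \<le> chain_cost w x zs"
  by (induction zs arbitrary: x) (auto simp: assms add_nonneg_nonneg)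

lemma chain_reverse:
  assumes sym: "\<And>x y. w x y = w y x"
  shows "\<exists>zs'. last (last (x # zs) # zs') = x \<and> chain_cost w (last (x # zs)) zs' = chain_cost w x zs"
proof (induction zs arbitrary: x)
  case Nil
  have "last (x # []) = x" by simp
  then show ?case by force
next
  case (Cons z zs)
  obtain zs' where z: "last (last (z # zs) # zs') = z"
    "chain_cost w (last (z # zs)) zs' = chain_cost w z zs"
    using Cons by blast
  have "last (last (x # z # zs) # (zs' @ [x])) = x"
    by simp
  moreover have "chain_cost w (last (x # z # zs)) (zs' @ [x]) = chain_cost w x (z # zs)"
    using z sym[of z x] by (simp add: chain_cost_append del: last.simps) (simp)
  ultimately show ?case by blast
qed

text \<open>Spend the budget \<open>h\<close> edge by edge. The edge into \<open>b\<close> is the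
  first one that overdraws it, or else the last edge of the chain; either way, what follows costs at
  most \<open>h'\<close>. The cut edge belongs to neither half.\<close>

lemma chain_split:
  assumes "\<And>x y. 0 \<le> w x y" "chain_cost w x zs \<le> h + h'" "zs \<noteq> []" "0 \<le> h" "0 \<le> h'"
  shows "\<exists>as b bs. zs = as @ b # bs \<and> chain_cost w x as \<le> h \<and> chain_cost w b bs \<le> h'"
  using assms(2-)
proof (induction zs arbitrary: x h)
  case (Cons z zs)
  show ?case
  proof (cases "w x z \<le> h \<and> zs \<noteq> []")
    case True
    with Cons.IH[of z "h - w x z"] Cons.prems
    obtain as b bs where "zs = as @ b # bs" "chain_cost w z as \<le> h - w x z" "chain_cost w b bs \<le> h'"
      by auto
    then have "z # zs = (z # as) @ b # bs \<and> chain_cost w x (z # as) \<le> h \<and> chain_cost w b bs \<le> h'"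
      by auto
    then show ?thesis by blast
  next
    case False
    then have "chain_cost w z zs \<le> h'"
      using Cons.prems by auto
    then show ?thesis
      using Cons.prems by (intro exI[of _ "[]"]) auto
  qed
qed auto

text \<open>Cut the chain at the edge that contains its midpoint with respect to cost.\<close>
lemma le_twice_chain_cost:
  assumes nonneg: "\<And>x y. 0 \<le> w x y" and refl: "\<And>x. w x x = 0"
    and triple: "\<And>a b c d \<epsilon>. \<lbrakk>w a b \<le> \<epsilon>; w b c \<le> \<epsilon>; w c d \<le> \<epsilon>\<rbrakk> \<Longrightarrow> w a d \<le> 2 * \<epsilon>"
  shows "w x (last (x # zs)) \<le> 2 * chain_cost w x zs"
proof (induction zs arbitrary: x rule: length_induct)
  case (1 zs)
  let ?S = "chain_cost w x zs"
  show ?case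
  proof (cases "zs = []")
    case True
    then show ?thesis using refl by simp
  next
    case False
    have S: "0 \<le> ?S" by (rule chain_cost_nonneg) (rule nonneg)
    obtain as b bs where zs: "zs = as @ b # bs"
      and as: "chain_cost w x as \<le> ?S / 2" and bs: "chain_cost w b bs \<le> ?S / 2"
      using chain_split[of w x zs "?S/2" "?S/2"] nonneg False S by auto
    let ?l = "last (x # as)"
    \<comment> \<open>The factor 2 of the induction hypothesis cancels the halving of the cost, so
      all three pieces are bounded by the same \<open>?S\<close>, as \<open>triple\<close>
      requires.\<close>
    have "w x ?l \<le> 2 * chain_cost w x as" "w b (last (b # bs)) \<le> 2 * chain_cost w b bs"
      using 1 zs by auto
    then have "w x ?l \<le> ?S" "w b (last (b # bs)) \<le> ?S"
      using as bs by linarith+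
    moreover have "w ?l b \<le> ?S"
      using chain_cost_nonneg[of w x as] chain_cost_nonneg[of w b bs] nonneg
      unfolding zs chain_cost_append by simp
    ultimately have "w x (last (b # bs)) \<le> 2 * ?S"
      using triple by blast
    then show ?thesis by (simp add: zs)
  qed
qed

text \<open>For nonnegative symmetric \<open>w\<close> this is the largest pseudometric below
  \<open>w\<close>.\<close>

definition chain_dist :: "('a \<Rightarrow> 'a \<Rightarrow> real) \<Rightarrow> 'a \<Rightarrow> 'a \<Rightarrow> real" where
  "chain_dist w x y = Inf {chain_cost w x zs | zs. last (x # zs) = y}"

text \<open>Reversing chains gives symmetry and concatenating them the triangle inequality. The weak
  triangle inequality \<open>triple\<close> stops long chains from becoming too cheap, so passing to
  the infimum loses at most a factor 2.\<close>

lemma chain_dist_properties: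
  assumes nonneg: "\<And>x y. 0 \<le> w x y" and refl: "\<And>x. w x x = 0"
    and sym: "\<And>x y. w x y = w y x"
    and triple: "\<And>a b c d \<epsilon>. \<lbrakk>w a b \<le> \<epsilon>; w b c \<le> \<epsilon>; w c d \<le> \<epsilon>\<rbrakk> \<Longrightarrow> w a d \<le> 2 * \<epsilon>"
  shows chain_dist_commute: "chain_dist w x y = chain_dist w y x"
    and chain_dist_triangle: "chain_dist w x z \<le> chain_dist w x y + chain_dist w y z"
    and chain_dist_le: "chain_dist w x y \<le> w x y"
    and le_chain_dist: "w x y \<le> 2 * chain_dist w x y"
proof -
  let ?C = "\<lambda>x y. {chain_cost w x zs | zs. last (x # zs) = y}"
  have ne: "w x y \<in> ?C x y" for x y
    by (rule CollectI, rule exI[of _ "[y]"]) simp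
  have bdd: "bdd_below (?C x y)" for x y
    using chain_cost_nonneg[of w] nonneg by (intro bdd_belowI[of _ 0]) auto
  have sub: "?C x y \<subseteq> ?C y x" for x y
  proof
    fix c assume "c \<in> ?C x y"
    then obtain zs where "c = chain_cost w x zs" "last (x # zs) = y" by blast
    moreover obtain zs' where "last (last (x # zs) # zs') = x"
      "chain_cost w (last (x # zs)) zs' = chain_cost w x zs"
      using chain_reverse[of w x zs, OF sym] by blast
    ultimately have "last (y # zs') = x \<and> c = chain_cost w y zs'" by simp
    then show "c \<in> ?C y x" by blast
  qed
  have "?C x y = ?C y x" by (rule subset_antisym) (rule sub)+
  then show "chain_dist w x y = chain_dist w y x"
    by (simp add: chain_dist_def)
  show "chain_dist w x y \<le> w x y"
    unfolding chain_dist_def using ne bdd by (rule cInf_lower)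
  have "w x y / 2 \<le> chain_dist w x y"
    unfolding chain_dist_def
  proof (rule cInf_greatest)
    show "?C x y \<noteq> {}" using ne by blast
  next
    fix c assume "c \<in> ?C x y"
    then obtain zs where "c = chain_cost w x zs" "last (x # zs) = y" by blast
    moreover have "w x (last (x # zs)) \<le> 2 * chain_cost w x zs"
      by (rule le_twice_chain_cost) (fact nonneg refl triple)+
    ultimately show "w x y / 2 \<le> c" by simp
  qed
  then show "w x y \<le> 2 * chain_dist w x y" by simp
  show "chain_dist w x z \<le> chain_dist w x y + chain_dist w y z"
  proof (rule field_le_epsilon)
    fix e :: real assume "0 < e"
    have "\<exists>c\<in>?C x y. c < chain_dist w x y + e/2" for x y
    proof (rule cInf_lessD)
      show "?C x y \<noteq> {}" using ne by blast
      show "Inf (?C x y) < chain_dist w x y + e/2" using \<open>0 < e\<close> by (simp add: chain_dist_def)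
    qed
    then obtain as bs where as: "last (x # as) = y" "chain_cost w x as < chain_dist w x y + e/2"
      and bs: "last (y # bs) = z" "chain_cost w y bs < chain_dist w y z + e/2"
      by blast
    have "last (x # as @ bs) = z"
      using as bs by (auto split: if_splits)
    then have "chain_cost w x (as @ bs) \<in> ?C x z" by blast
    then have "chain_dist w x z \<le> chain_cost w x (as @ bs)"
      unfolding chain_dist_def using bdd by (rule cInf_lower)
    also have "\<dots> = chain_cost w x as + chain_cost w y bs"
      using as by (simp add: chain_cost_append)
    finally show "chain_dist w x z \<le> chain_dist w x y + chain_dist w y z + e"
      using as bs by linarith
  qed
qed

text \<open>Alexandroff--Urysohn metrization, phrased through a countable base \<open>R k\<close> of entourages.\<close>
theorem metrizable_space_entourages:
  fixes R :: "nat \<Rightarrow> 'a \<Rightarrow> 'a \<Rightarrow> bool"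
  assumes refl: "\<And>k x. R k x x" and sym: "\<And>k x y. R k x y \<Longrightarrow> R k y x"
    and comp: "\<And>k a b c d. \<lbrakk>R (Suc k) a b; R (Suc k) b c; R (Suc k) c d\<rbrakk> \<Longrightarrow> R k a d"
    and sep: "\<And>x y. \<lbrakk>x \<in> topspace X; y \<in> topspace X; x \<noteq> y\<rbrakk> \<Longrightarrow> \<exists>k. \<not> R k x y"
    and op: "\<And>U. openin X U \<longleftrightarrow>
        U \<subseteq> topspace X \<and> (\<forall>x\<in>U. \<exists>k. \<forall>y\<in>topspace X. R k x y \<longrightarrow> y \<in> U)"
  shows "metrizable_space X"
proof -
  \<comment> \<open>\<open>w x y\<close> is \<open>(1/2) ^ k\<close> for the least \<open>k\<close>
    at which \<open>R k x y\<close> fails; the inserted 0 is its value when no \<open>k\<close>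
    fails.\<close>
  define A :: "'a \<Rightarrow> 'a \<Rightarrow> real set"
    where "A x y = insert 0 {(1/2) ^ k | k. \<not> R k x y}" for x y
  define w :: "'a \<Rightarrow> 'a \<Rightarrow> real" where "w x y = Sup (A x y)" for x y
  have bdd: "bdd_above (A x y)" for x y
    unfolding A_def by (intro bdd_aboveI[of _ 1]) (auto simp: power_le_one)
  have w_le: "w x y \<le> e \<longleftrightarrow> 0 \<le> e \<and> (\<forall>k. \<not> R k x y \<longrightarrow> (1/2) ^ k \<le> e)" for x y e
  proof -
    have "w x y \<le> e \<longleftrightarrow> (\<forall>a\<in>A x y. a \<le> e)"
      unfolding w_def by (rule cSup_le_iff) (use bdd in \<open>auto simp: A_def\<close>)
    then show ?thesis by (auto simp: A_def)
  qed
  have nonneg: "0 \<le> w x y" for x y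
    unfolding w_def by (rule cSup_upper[OF _ bdd]) (simp add: A_def)
  have dec: "R k x y" if "R (Suc k) x y" for k x y
    using comp that refl by blast
  have dec': "R j x y" if "R k x y" "j \<le> k" for j k x y
    using that(2,1) by (induction rule: dec_induct) (use dec in auto)
  have wrefl: "w x x = 0" for x
    using w_le[of x x 0] nonneg[of x x] refl by (simp add: order_antisym)
  have wsym: "w x y = w y x" for x y
    unfolding w_def A_def using sym by metis
  \<comment> \<open>Descending from level \<open>Suc k\<close> to level \<open>k\<close> costs
    exactly the factor 2 that the chain argument allows.\<close>
  have triple: "w a d \<le> 2 * e" if "w a b \<le> e" "w b c \<le> e" "w c d \<le> e" for a b c d e
    unfolding w_le
  proof (intro conjI allI impI)
    show "0 \<le> 2 * e" using that w_le by simp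
    fix k assume "\<not> R k a d"
    then have "\<not> R (Suc k) a b \<or> \<not> R (Suc k) b c \<or> \<not> R (Suc k) c d"
      using comp by blast
    then have "(1/2) ^ Suc k \<le> e" using that unfolding w_le by blast
    then show "(1/2) ^ k \<le> 2 * e" by simp
  qed
  have R_imp: "w x y \<le> (1/2) ^ Suc k" if "R k x y" for k x y
    unfolding w_le
  proof (intro conjI allI impI)
    fix j assume "\<not> R j x y"
    then have "Suc k \<le> j" using dec'[OF that] by (meson not_less_eq_eq)
    then show "(1/2::real) ^ j \<le> (1/2) ^ Suc k" by (intro power_decreasing) auto
  qed auto
  have imp_R: "R k x y" if "w x y < (1/2) ^ k" for k x y
    using w_le[of x y "w x y"] that by force
  let ?d = "chain_dist w"
  have d_comm: "?d x y = ?d y x" for x y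
    by (rule chain_dist_commute) (fact nonneg wrefl wsym triple)+
  have d_triangle: "?d x z \<le> ?d x y + ?d y z" for x y z
    by (rule chain_dist_triangle) (fact nonneg wrefl wsym triple)+
  have d_le: "?d x y \<le> w x y" for x y
    by (rule chain_dist_le) (fact nonneg wrefl wsym triple)+
  have le_d: "w x y \<le> 2 * ?d x y" for x y
    by (rule le_chain_dist) (fact nonneg wrefl wsym triple)+
  have d_nonneg: "0 \<le> ?d x y" for x y
    using nonneg[of x y] le_d[of x y] by linarith
  interpret Metric_space "topspace X" ?d
  proof
    fix x y z :: 'a
    show "0 \<le> ?d x y" by (rule d_nonneg)
    show "?d x y = ?d y x" by (rule d_comm)
    show "?d x z \<le> ?d x y + ?d y z" by (rule d_triangle)
    assume xy: "x \<in> topspace X" "y \<in> topspace X"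
    show "?d x y = 0 \<longleftrightarrow> x = y"
    proof
      assume 0: "?d x y = 0"
      then have "w x y \<le> 0" using le_d[of x y] by simp
      then have "w x y < (1/2) ^ k" for k
        by (rule le_less_trans) simp
      then show "x = y" using imp_R sep[OF xy] by blast
    next
      assume "x = y"
      then show "?d x y = 0"
        using d_le[of x x] d_nonneg[of x x] wrefl by simp
    qed
  qed
  have "openin X U \<longleftrightarrow> openin mtopology U" for U
    unfolding op openin_mtopology
  proof (intro conj_cong refl iffI allI ballI impI)
    fix x assume U: "U \<subseteq> topspace X" and *: "\<forall>x\<in>U. \<exists>k. \<forall>y\<in>topspace X. R k x y \<longrightarrow> y \<in> U" and "x \<in> U"
    then obtain k where k: "\<forall>y\<in>topspace X. R k x y \<longrightarrow> y \<in> U" by blast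
    \<comment> \<open>The exponent \<open>Suc k\<close> absorbs the factor 2 lost between
      \<open>?d\<close> and \<open>w\<close>.\<close>
    have "mball x ((1/2) ^ Suc k) \<subseteq> U"
    proof
      fix y assume "y \<in> mball x ((1/2) ^ Suc k)"
      then have "y \<in> topspace X" "?d x y < (1/2) ^ Suc k" by auto
      moreover from this have "w x y < (1/2) ^ k" using le_d[of x y] by simp
      ultimately show "y \<in> U" using k imp_R by blast
    qed
    then show "\<exists>r>0. mball x r \<subseteq> U"
      by (intro exI[of _ "(1/2) ^ Suc k"]) auto
  next
    fix x assume U: "U \<subseteq> topspace X" and *: "\<forall>x. x \<in> U \<longrightarrow> (\<exists>r>0. mball x r \<subseteq> U)" and x: "x \<in> U"
    then obtain r where r: "r > 0" "mball x r \<subseteq> U" by blast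
    obtain k where k: "(1/2) ^ k < r"
      using real_arch_pow_inv[of r "1/2"] r by auto
    have "y \<in> U" if "y \<in> topspace X" "R k x y" for y
    proof -
      have "?d x y \<le> w x y" by (rule d_le)
      also have "\<dots> \<le> (1/2) ^ Suc k" by (rule R_imp[OF that(2)])
      also have "\<dots> \<le> (1/2) ^ k" by simp
      also have "\<dots> < r" by (rule k)
      finally have "y \<in> mball x r" using x U that by auto
      then show ?thesis using r by blast
    qed
    then show "\<exists>k. \<forall>y\<in>topspace X. R k x y \<longrightarrow> y \<in> U" by blast
  qed
  then have "X = mtopology" by (simp add: topology_eq)
  then show ?thesis
    using metrizable_space_mtopology by simp
qed

text \<open>
  Frink's metrization theorem. Iterating \<open>m\<close> along each point yields the members
  \<open>W (N k x) x\<close> of a sequence of covers such that the union of two intersecting members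
  of one cover lies in a member of the previous cover.
\<close>
theorem metrizable_space_Frink:
  fixes W :: "nat \<Rightarrow> 'a \<Rightarrow> 'a set"
  assumes t1: "t1_space X"
    and mem: "\<And>n x. x \<in> topspace X \<Longrightarrow> x \<in> W n x"
    and dec: "\<And>m n x. \<lbrakk>x \<in> topspace X; m \<le> n\<rbrakk> \<Longrightarrow> W n x \<subseteq> W m x"
    and op: "\<And>U. openin X U \<longleftrightarrow> U \<subseteq> topspace X \<and> (\<forall>x\<in>U. \<exists>n. W n x \<inter> topspace X \<subseteq> U)"
    and frink: "\<And>n x. x \<in> topspace X \<Longrightarrow>
        \<exists>m. \<forall>y\<in>topspace X. W m x \<inter> W m y \<noteq> {} \<longrightarrow> W m y \<subseteq> W n x"
  shows "metrizable_space X"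
proof -
  have "\<exists>m>n. \<forall>y\<in>topspace X. W m x \<inter> W m y \<noteq> {} \<longrightarrow> W m y \<subseteq> W n x" if x: "x \<in> topspace X" for n x
  proof -
    obtain m where m: "\<forall>y\<in>topspace X. W m x \<inter> W m y \<noteq> {} \<longrightarrow> W m y \<subseteq> W n x"
      using frink[OF x] by blast
    let ?m = "max m (Suc n)"
    have "W ?m y \<subseteq> W n x" if "y \<in> topspace X" "W ?m x \<inter> W ?m y \<noteq> {}" for y
      using m that x dec[of y m ?m] dec[of x m ?m] by fastforce
    then show ?thesis
      by (intro exI[of _ ?m]) auto
  qed
  then have "\<forall>n x. \<exists>m. x \<in> topspace X \<longrightarrow>
      m > n \<and> (\<forall>y\<in>topspace X. W m x \<inter> W m y \<noteq> {} \<longrightarrow> W m y \<subseteq> W n x)"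
    by blast
  then obtain m where "\<forall>n x. x \<in> topspace X \<longrightarrow>
      m n x > n \<and> (\<forall>y\<in>topspace X. W (m n x) x \<inter> W (m n x) y \<noteq> {} \<longrightarrow> W (m n x) y \<subseteq> W n x)"
    unfolding choice_iff by blast
  then have m_gt: "\<And>n x. x \<in> topspace X \<Longrightarrow> m n x > n"
    and m: "\<And>n x y. \<lbrakk>x \<in> topspace X; y \<in> topspace X; W (m n x) x \<inter> W (m n x) y \<noteq> {}\<rbrakk>
        \<Longrightarrow> W (m n x) y \<subseteq> W n x"
    by blast+
  \<comment> \<open>Each point advances at the speed set by its own Frink index;
    \<open>m n x > n\<close> ensures that \<open>N k x\<close> is at least \<open>k\<close>.\<close>
  define N where "N k x = ((\<lambda>n. m n x) ^^ k) 0" for k x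
  have N_Suc: "N (Suc k) x = m (N k x) x" for k x
    by (simp add: N_def)
  have N_ge: "k \<le> N k x" if "x \<in> topspace X" for k x
  proof (induction k)
    case (Suc k)
    then show ?case using m_gt[OF that, of "N k x"] by (simp add: N_Suc)
  qed simp
  \<comment> \<open>Two points are close if one member of the \<open>k\<close>-th cover contains
    both. The disjunct \<open>x = y\<close> gives reflexivity also outside
    \<open>topspace X\<close>.\<close>
  define Q where "Q k x y \<longleftrightarrow> x = y \<or> (\<exists>z\<in>topspace X. x \<in> W (N k z) z \<and> y \<in> W (N k z) z)" for k x y
  \<comment> \<open>The set at \<open>v\<close> only grows when its index drops to
    \<open>N (Suc k) u\<close>, which is \<open>m (N k u) u\<close>; then Frink's condition at
    \<open>u\<close> applies. Of two meeting members, the one with the smaller index thus determines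
    the member containing both.\<close>
  have union: "W (N (Suc k) u) u \<union> W (N (Suc k) v) v \<subseteq> W (N k u) u"
    if "u \<in> topspace X" "v \<in> topspace X" "W (N (Suc k) u) u \<inter> W (N (Suc k) v) v \<noteq> {}"
      "N (Suc k) u \<le> N (Suc k) v" for k u v
  proof -
    have "W (N (Suc k) v) v \<subseteq> W (N (Suc k) u) v"
      using dec that by blast
    moreover from this have "W (N (Suc k) u) v \<subseteq> W (N k u) u"
      using m[of u v "N k u"] that unfolding N_Suc by blast
    moreover have "W (N (Suc k) u) u \<subseteq> W (N k u) u"
      using dec[of u "N k u" "N (Suc k) u"] m_gt[of u "N k u"] that unfolding N_Suc by simp
    ultimately show ?thesis by blast
  qed
  have Q2: "Q k a c" if ab: "Q (Suc k) a b" and bc: "Q (Suc k) b c" for k a b c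
  proof (cases "a = b \<or> b = c")
    case True
    have "W (N (Suc k) z) z \<subseteq> W (N k z) z" if "z \<in> topspace X" for z
      using union[of z z k] mem that by auto
    then have "Q k x y" if "Q (Suc k) x y" for x y
      using that unfolding Q_def by blast
    then show ?thesis using True ab bc by auto
  next
    case False
    then obtain u v where u: "u \<in> topspace X" "a \<in> W (N (Suc k) u) u" "b \<in> W (N (Suc k) u) u"
      and v: "v \<in> topspace X" "b \<in> W (N (Suc k) v) v" "c \<in> W (N (Suc k) v) v"
      using ab bc unfolding Q_def by blast
    show ?thesis
    proof (cases "N (Suc k) u \<le> N (Suc k) v")
      case True
      then have "W (N (Suc k) u) u \<union> W (N (Suc k) v) v \<subseteq> W (N k u) u"
        using u v by (intro union) auto
      then show ?thesis using u v unfolding Q_def by blast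
    next
      case False
      then have "W (N (Suc k) v) v \<union> W (N (Suc k) u) u \<subseteq> W (N k v) v"
        using u v by (intro union) auto
      then show ?thesis using u v unfolding Q_def by blast
    qed
  qed
  have Q_refl: "Q k x x" for k x by (simp add: Q_def)
  have Q_sym: "Q k y x" if "Q k x y" for k x y
    using that unfolding Q_def by blast
  have star: "\<exists>k. \<forall>y\<in>topspace X. Q k x y \<longrightarrow> y \<in> W n x" if x: "x \<in> topspace X" for n x
  proof -
    \<comment> \<open>A member of stage \<open>m n x\<close> with centre \<open>z\<close> has index
      at least \<open>m n x\<close>. If it contains \<open>x\<close>, it lies in
      \<open>W (m n x) z\<close>, which meets \<open>W (m n x) x\<close> in
      \<open>x\<close>.\<close>
    have "y \<in> W n x" if y: "Q (m n x) x y" for y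
    proof (cases "x = y")
      case False
      then obtain z where z: "z \<in> topspace X" "x \<in> W (N (m n x) z) z" "y \<in> W (N (m n x) z) z"
        using y unfolding Q_def by blast
      moreover have "W (N (m n x) z) z \<subseteq> W (m n x) z"
        using dec N_ge z by blast
      moreover from calculation have "W (m n x) z \<subseteq> W n x"
        using mem[OF x] m[OF x] by blast
      ultimately show ?thesis by blast
    qed (use mem x in auto)
    then show ?thesis by blast
  qed
  have Q_dec: "Q j x y" if "Q k x y" "j \<le> k" for j k x y
    using that(2,1) by (induction rule: dec_induct) (use Q2 Q_refl in blast)+
  have Q_op: "openin X U \<longleftrightarrow>
      U \<subseteq> topspace X \<and> (\<forall>x\<in>U. \<exists>k. \<forall>y\<in>topspace X. Q k x y \<longrightarrow> y \<in> U)" for U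
    unfolding op
  proof (intro conj_cong refl ball_cong iffI)
    fix x assume U: "U \<subseteq> topspace X" "x \<in> U" and "\<exists>n. W n x \<inter> topspace X \<subseteq> U"
    then show "\<exists>k. \<forall>y\<in>topspace X. Q k x y \<longrightarrow> y \<in> U"
      using star[of x] by blast
  next
    fix x assume U: "U \<subseteq> topspace X" "x \<in> U" and "\<exists>k. \<forall>y\<in>topspace X. Q k x y \<longrightarrow> y \<in> U"
    then obtain k where k: "\<forall>y\<in>topspace X. Q k x y \<longrightarrow> y \<in> U" by blast
    then have "W (N k x) x \<inter> topspace X \<subseteq> U"
      using mem U unfolding Q_def by blast
    then show "\<exists>n. W n x \<inter> topspace X \<subseteq> U" by blast
  qed
  \<comment> \<open>\<open>Q2\<close> composes two steps per level, whereas entourages must compose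
    three; hence only even levels are used.\<close>
  show ?thesis
  proof (rule metrizable_space_entourages[where R = "\<lambda>k. Q (2 * k)"])
    show "Q (2 * k) x x" for k x by (rule Q_refl)
    show "Q (2 * k) y x" if "Q (2 * k) x y" for k x y using that by (rule Q_sym)
    show "Q (2 * k) a d" if "Q (2 * Suc k) a b" "Q (2 * Suc k) b c" "Q (2 * Suc k) c d" for k a b c d
    proof -
      have "Q (Suc (2 * k)) a c"
        by (rule Q2[of _ a b]) (use that in simp_all)
      moreover have "Q (Suc (2 * k)) c d"
        using Q_dec[OF that(3)] by simp
      ultimately show ?thesis by (rule Q2)
    qed
    have double: "(\<exists>k. \<forall>y\<in>topspace X. Q k x y \<longrightarrow> y \<in> U) \<longleftrightarrow>
        (\<exists>k. \<forall>y\<in>topspace X. Q (2 * k) x y \<longrightarrow> y \<in> U)" for x U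
      using Q_dec[of "2 * k" x _ k for k] by (metis le_add1 mult_2)
    show "openin X U \<longleftrightarrow>
        U \<subseteq> topspace X \<and> (\<forall>x\<in>U. \<exists>k. \<forall>y\<in>topspace X. Q (2 * k) x y \<longrightarrow> y \<in> U)" for U
      unfolding Q_op double ..
    show "\<exists>k. \<not> Q (2 * k) x y" if xy: "x \<in> topspace X" "y \<in> topspace X" "x \<noteq> y" for x y
    proof -
      have "openin X (topspace X - {y})"
        using t1 xy by (simp add: t1_space_openin_delete_alt)
      then obtain k where "\<forall>z\<in>topspace X. Q (2 * k) x z \<longrightarrow> z \<in> topspace X - {y}"
        using xy unfolding Q_op double by blast
      then show ?thesis using xy by blast
    qed
  qed
qed

section \<open>Gyrogroups\<close>

context gyrogroup
begin

lemma inv_properties: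
  assumes "x \<in> carrier G"
  shows inv_elem_closed: "inv x \<in> carrier G"
    and inv_left: "inv x \<otimes> x = \<one>"
    and inv_right: "x \<otimes> inv x = \<one>"
proof -
  have "\<exists>!y. y \<in> carrier G \<and> x \<otimes> y = \<one> \<and> y \<otimes> x = \<one>"
    using inverse[OF assms] by metis
  from theI'[OF this] show "inv x \<in> carrier G" "inv x \<otimes> x = \<one>" "x \<otimes> inv x = \<one>"
    unfolding m_inv_def by auto
qed

lemma inv_inv_elem: "x \<in> carrier G \<Longrightarrow> inv (inv x) = x"
  using inverse[of "inv x"] inv_properties[of x] inv_properties[of "inv x"] by blast

lemma inv_one_elem: "inv \<one> = \<one>"
  using inv_left[OF one_closed] identity[OF inv_elem_closed[OF one_closed]] by simp

lemma gyrE: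
  obtains gyr where "\<And>x y z. \<lbrakk>x \<in> carrier G; y \<in> carrier G; z \<in> carrier G\<rbrakk> \<Longrightarrow> gyr x y z \<in> carrier G"
    and "\<And>x y. \<lbrakk>x \<in> carrier G; y \<in> carrier G\<rbrakk> \<Longrightarrow> inj_on (gyr x y) (carrier G)"
    and "\<And>x y z. \<lbrakk>x \<in> carrier G; y \<in> carrier G; z \<in> carrier G\<rbrakk> \<Longrightarrow> x \<otimes> (y \<otimes> z) = (x \<otimes> y) \<otimes> gyr x y z"
    and "\<And>x y z. \<lbrakk>x \<in> carrier G; y \<in> carrier G; z \<in> carrier G\<rbrakk> \<Longrightarrow> gyr (x \<otimes> y) y z = gyr x y z"
proof -
  obtain gyr where iso: "\<forall>x\<in>carrier G. \<forall>y\<in>carrier G. gyr x y \<in> iso G G \<and>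
                (\<forall>z\<in>carrier G. x \<otimes> (y \<otimes> z) = (x \<otimes> y) \<otimes> gyr x y z)"
    and loop: "\<forall>x\<in>carrier G. \<forall>y\<in>carrier G. \<forall>z\<in>carrier G. gyr (x \<otimes> y) y z = gyr x y z"
    using gyration by blast
  have bij: "bij_betw (gyr x y) (carrier G) (carrier G)" if "x \<in> carrier G" "y \<in> carrier G" for x y
    using iso that unfolding iso_def by blast
  show thesis
  proof (rule that[of gyr])
    show "gyr x y z \<in> carrier G" if "x \<in> carrier G" "y \<in> carrier G" "z \<in> carrier G" for x y z
      using bij that by (meson bij_betwE)
    show "inj_on (gyr x y) (carrier G)" if "x \<in> carrier G" "y \<in> carrier G" for x y
      using bij that by (meson bij_betw_imp_inj_on)
  qed (use iso loop in auto)
qed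

text \<open>The left side equals \<open>gyr (inv x) x y\<close>, and the loop property turns this
  into \<open>gyr \<one> x y\<close>. The latter is \<open>y\<close>, because
  \<open>x \<otimes> y = x \<otimes> gyr \<one> x y\<close> and left multiplication by
  \<open>x\<close> inherits injectivity from \<open>gyr (inv x) x\<close>.\<close>

lemma left_cancel:
  assumes x: "x \<in> carrier G" and y: "y \<in> carrier G"
  shows "inv x \<otimes> (x \<otimes> y) = y"
proof -
  obtain gyr where gc: "\<And>x y z. \<lbrakk>x \<in> carrier G; y \<in> carrier G; z \<in> carrier G\<rbrakk> \<Longrightarrow> gyr x y z \<in> carrier G"
    and inj: "\<And>x y. \<lbrakk>x \<in> carrier G; y \<in> carrier G\<rbrakk> \<Longrightarrow> inj_on (gyr x y) (carrier G)"
    and assoc: "\<And>x y z. \<lbrakk>x \<in> carrier G; y \<in> carrier G; z \<in> carrier G\<rbrakk> \<Longrightarrow> x \<otimes> (y \<otimes> z) = (x \<otimes> y) \<otimes> gyr x y z"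
    and loop: "\<And>x y z. \<lbrakk>x \<in> carrier G; y \<in> carrier G; z \<in> carrier G\<rbrakk> \<Longrightarrow> gyr (x \<otimes> y) y z = gyr x y z"
    using gyrE by blast
  note [simp] = x inv_elem_closed inv_left gc one_closed
  have *: "inv x \<otimes> (x \<otimes> z) = gyr (inv x) x z" if "z \<in> carrier G" for z
    using assoc[of "inv x" x z] identity[of "gyr (inv x) x z"] that by simp
  have "x \<otimes> y = x \<otimes> gyr \<one> x y"
    using assoc[of \<one> x y] y identity closed by simp
  then have "gyr (inv x) x y = gyr (inv x) x (gyr \<one> x y)"
    using *[of y] *[of "gyr \<one> x y"] y by simp
  then have "gyr \<one> x y = y"
    using inj[of "inv x" x] y by (simp add: inj_on_eq_iff)
  moreover have "gyr \<one> x y = gyr (inv x) x y"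
    using loop[of "inv x" x y] y by simp
  ultimately show ?thesis using * y by simp
qed

lemma left_cancel_inv:
  assumes "x \<in> carrier G" and "y \<in> carrier G"
  shows "x \<otimes> (inv x \<otimes> y) = y"
  using left_cancel[of "inv x" y] assms inv_elem_closed inv_inv_elem by simp

text \<open>
  The loop property gives \<open>gyr y v = gyr (y \<otimes> v) v\<close>, so that \<open>y\<close> becomes
  a word in \<open>y \<otimes> v\<close> and \<open>v\<close>.
\<close>
lemma right_divide:
  assumes y: "y \<in> carrier G" and v: "v \<in> carrier G" and z: "z = y \<otimes> v"
  shows "y = z \<otimes> (inv (z \<otimes> v) \<otimes> z)"
proof -
  obtain gyr where gc: "\<And>x y z. \<lbrakk>x \<in> carrier G; y \<in> carrier G; z \<in> carrier G\<rbrakk> \<Longrightarrow> gyr x y z \<in> carrier G"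
    and "\<And>x y. \<lbrakk>x \<in> carrier G; y \<in> carrier G\<rbrakk> \<Longrightarrow> inj_on (gyr x y) (carrier G)"
    and assoc: "\<And>x y z. \<lbrakk>x \<in> carrier G; y \<in> carrier G; z \<in> carrier G\<rbrakk> \<Longrightarrow> x \<otimes> (y \<otimes> z) = (x \<otimes> y) \<otimes> gyr x y z"
    and loop: "\<And>x y z. \<lbrakk>x \<in> carrier G; y \<in> carrier G; z \<in> carrier G\<rbrakk> \<Longrightarrow> gyr (x \<otimes> y) y z = gyr x y z"
    using gyrE by blast
  have iv: "inv v \<in> carrier G" and zc: "z \<in> carrier G" and zv: "z \<otimes> v \<in> carrier G"
    using y v closed inv_elem_closed by (auto simp: z)
  let ?g = "gyr z v (inv v)"
  have "z = (z \<otimes> v) \<otimes> ?g"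
    using assoc[OF zc v iv] inv_right[OF v] identity[OF zc] by simp
  then have "inv (z \<otimes> v) \<otimes> z = ?g"
    using left_cancel[OF zv gc[OF zc v iv]] by simp
  moreover have "y = z \<otimes> gyr y v (inv v)"
    using assoc[OF y v iv] inv_right[OF v] identity[OF y] by (simp add: z)
  ultimately show ?thesis
    using loop[OF y v iv] by (simp add: z)
qed

end

section \<open>Topological gyrogroups\<close>

context topological_gyrogroup
begin

lemma limitin_mult:
  assumes "limitin T f a F" "limitin T g b F"
  shows "limitin T (\<lambda>i. f i \<otimes> g i) (a \<otimes> b) F"
proof -
  have "limitin (prod_topology T T) (\<lambda>i. (f i, g i)) (a, b) F"
    using assms by (simp add: limitin_pairwise o_def)
  from continuous_map_limit[OF continuous_mult this] show ?thesis
    by (simp add: o_def)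
qed

lemma limitin_inv:
  assumes "limitin T f a F"
  shows "limitin T (\<lambda>i. inv (f i)) (inv a) F"
  using continuous_map_limit[OF continuous_inv assms] by (simp add: o_def)

lemma continuous_map_left_mult:
  assumes "x \<in> carrier G"
  shows "continuous_map T T (\<lambda>y. x \<otimes> y)"
proof -
  have "continuous_map T (prod_topology T T) (\<lambda>y. (x, y))"
    using assms by (auto simp: continuous_map_pairwise o_def topspace_eq)
  from continuous_map_compose[OF this continuous_mult] show ?thesis
    by (simp add: o_def)
qed

lemma metrizable_if_countable_base_one:
  assumes t1: "t1_space T" and B: "countable B"
    and B_op: "\<And>V. V \<in> B \<Longrightarrow> openin T V \<and> \<one> \<in> V"
    and B_base: "\<And>S. \<lbrakk>openin T S; \<one> \<in> S\<rbrakk> \<Longrightarrow> \<exists>V\<in>B. V \<subseteq> S"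
  shows "metrizable_space T"
proof -
  have "B \<noteq> {}"
    using B_base[OF openin_topspace] one_closed topspace_eq by auto
  define U where "U n = (\<Inter>i\<le>n. from_nat_into B i)" for n
  have U_op: "openin T (U n)" and U_one: "\<one> \<in> U n" for n
    unfolding U_def using B_op from_nat_into[OF \<open>B \<noteq> {}\<close>] by auto
  have U_dec: "U n \<subseteq> U m" if "m \<le> n" for m n
    unfolding U_def using that by auto
  have U_base: "\<exists>n. U n \<subseteq> S" if S: "openin T S" "\<one> \<in> S" for S
  proof -
    obtain V where V: "V \<in> B" "V \<subseteq> S" using B_base[OF S] by blast
    then obtain n where "from_nat_into B n = V"
      using from_nat_into_surj[OF B] by blast
    then have "U n \<subseteq> V" unfolding U_def by blast
    then show ?thesis using V by blast
  qed
  \<comment> \<open>This lets Frink's condition be refuted or verified through sequences, one point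
    for each index.\<close>
  have U_lim: "limitin T u \<one> sequentially" if "\<And>n. u n \<in> U n" for u
    unfolding limitin_sequentially
    using U_base U_dec that one_closed topspace_eq by (metis subsetD)
  \<comment> \<open>The translate \<open>x \<otimes> U n\<close>, written as a preimage so that it
    is open by continuity of left multiplication by \<open>inv x\<close>.\<close>
  define W where "W n x = {y \<in> carrier G. inv x \<otimes> y \<in> U n}" for n x
  have base: "\<exists>n. W n x \<subseteq> S" if S: "openin T S" "x \<in> S" for S x
  proof -
    have x: "x \<in> carrier G" using S openin_subset topspace_eq by blast
    have "openin T {u \<in> topspace T. x \<otimes> u \<in> S}"
      using openin_continuous_map_preimage[OF continuous_map_left_mult[OF x] S(1)] .
    then obtain n where n: "U n \<subseteq> {u \<in> topspace T. x \<otimes> u \<in> S}"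
      using U_base[of "{u \<in> topspace T. x \<otimes> u \<in> S}"] S x identity one_closed topspace_eq by auto
    have "W n x \<subseteq> S"
      using n left_cancel_inv[OF x] unfolding W_def by fastforce
    then show ?thesis by blast
  qed
  have W_op: "openin T (W n x)" if "x \<in> carrier G" for n x
    using openin_continuous_map_preimage[OF continuous_map_left_mult[OF inv_elem_closed[OF that]] U_op]
    by (simp add: W_def topspace_eq)
  have W_mem: "x \<in> W n x" if "x \<in> carrier G" for n x
    using that U_one inv_left by (simp add: W_def)
  show ?thesis
  proof (rule metrizable_space_Frink[OF t1, of W])
    fix n x assume "x \<in> topspace T"
    then show "x \<in> W n x" using W_mem topspace_eq by simp
  next
    fix m n x assume "m \<le> (n::nat)"
    then show "W n x \<subseteq> W m x" using U_dec unfolding W_def by blast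
  next
    fix S show "openin T S \<longleftrightarrow> S \<subseteq> topspace T \<and> (\<forall>x\<in>S. \<exists>n. W n x \<inter> topspace T \<subseteq> S)"
    proof (intro iffI conjI)
      assume S: "S \<subseteq> topspace T \<and> (\<forall>x\<in>S. \<exists>n. W n x \<inter> topspace T \<subseteq> S)"
      have "\<exists>V. openin T V \<and> x \<in> V \<and> V \<subseteq> S" if x: "x \<in> S" for x
      proof -
        obtain n where "W n x \<inter> topspace T \<subseteq> S" using S x by blast
        moreover have "x \<in> carrier G" using S x topspace_eq by blast
        ultimately show ?thesis
          using W_op[of x n] W_mem[of x n] openin_subset[of T "W n x"] by blast
      qed
      then show "openin T S" by (subst openin_subopen) blast
    next
      assume S: "openin T S"
      then show "S \<subseteq> topspace T" by (rule openin_subset)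
      show "\<forall>x\<in>S. \<exists>n. W n x \<inter> topspace T \<subseteq> S"
        using base[OF S] by (meson le_infI1)
    qed
  next
    fix n x assume "x \<in> topspace T"
    then have x: "x \<in> carrier G" using topspace_eq by simp
    then have xt: "limitin T (\<lambda>_. x) x sequentially" by (simp add: topspace_eq)
    show "\<exists>m. \<forall>y\<in>topspace T. W m x \<inter> W m y \<noteq> {} \<longrightarrow> W m y \<subseteq> W n x"
    proof (rule ccontr)
      assume "\<not> ?thesis"
      then have "\<forall>m. \<exists>y z w. y \<in> carrier G \<and> z \<in> W m x \<and> z \<in> W m y \<and> w \<in> W m y \<and> w \<notin> W n x"
        unfolding topspace_eq by blast
      then obtain y z w where y: "\<And>m. y m \<in> carrier G" and z: "\<And>m. z m \<in> W m x" "\<And>m. z m \<in> W m (y m)"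
        and w: "\<And>m. w m \<in> W m (y m)" "\<And>m. w m \<notin> W n x"
        by metis
      have zw: "z m \<in> carrier G" "w m \<in> carrier G" for m
        using z w unfolding W_def by auto
      define v where "v m = inv (y m) \<otimes> z m" for m
      have v_lim: "limitin T v \<one> sequentially"
        and "limitin T (\<lambda>m. inv x \<otimes> z m) \<one> sequentially"
        and w_lim: "limitin T (\<lambda>m. inv (y m) \<otimes> w m) \<one> sequentially"
        using z w unfolding v_def W_def by (auto intro!: U_lim)
      from limitin_mult[OF xt this(2)] have z_lim: "limitin T z x sequentially"
        using x zw left_cancel_inv identity by simp
      \<comment> \<open>As \<open>z m = y m \<otimes> v m\<close>, right division recovers
        \<open>y m\<close> as a word in \<open>z m\<close> and \<open>v m\<close>; at the limits
        \<open>x\<close> and \<open>\<one>\<close> this word has value \<open>x\<close>.\<close>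
      have "z m \<otimes> (inv (z m \<otimes> v m) \<otimes> z m) = y m" for m
        using y zw left_cancel_inv closed inv_elem_closed
        by (intro right_divide[symmetric]) (auto simp: v_def)
      moreover have "limitin T (\<lambda>m. z m \<otimes> (inv (z m \<otimes> v m) \<otimes> z m)) (x \<otimes> (inv (x \<otimes> \<one>) \<otimes> x)) sequentially"
        by (intro limitin_mult limitin_inv z_lim v_lim)
      ultimately have "limitin T y x sequentially"
        using x by (simp add: identity inv_left)
      from limitin_mult[OF this w_lim] have "limitin T w x sequentially"
        using x y zw left_cancel_inv identity by simp
      then have "\<forall>\<^sub>F m in sequentially. w m \<in> W n x"
        using W_op[OF x] W_mem[OF x] by (rule limitinD)
      then show False using w by simp
    qed
  qed
qed

text \<open>
  Translate \<open>A k\<close> to the point \<open>z k\<close> of a nontrivial sequence converging to \<open>\<one>\<close>, and let a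
  sequence in the union of the translates converge to \<open>\<one>\<close>. It meets only finitely often the
  part of each translate that is near \<open>z k\<close>, and translating back by the \<open>z (k i)\<close> keeps the limit.
\<close>
lemma strongly_Frechet_at_one:
  fixes A :: "nat \<Rightarrow> 'a set"
  assumes haus: "Hausdorff_space T" and FU: "Frechet_Urysohn_space T"
    and not_isolated: "\<not> openin T {\<one>}"
    and A_sub: "\<And>k. A k \<subseteq> carrier G" and A_cl: "\<And>k. \<one> \<in> T closure_of A k"
  obtains a k where "limitin T a \<one> sequentially" "filterlim k at_top sequentially" "\<And>i. a i \<in> A (k i)"
proof -
  have "\<one> \<in> T closure_of (carrier G - {\<one>})"
  proof (rule ccontr)
    assume "\<not> ?thesis"
    then obtain V where "openin T V" "\<one> \<in> V" "V \<inter> (carrier G - {\<one>}) = {}"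
      using one_closed topspace_eq unfolding in_closure_of by auto
    moreover from this have "V = {\<one>}" using openin_subset topspace_eq by blast
    ultimately show False using not_isolated by simp
  qed
  then obtain z where z: "\<And>k. z k \<in> carrier G" "\<And>k. z k \<noteq> \<one>" and z_lim: "limitin T z \<one> sequentially"
    using FU unfolding Frechet_Urysohn_space_def topspace_eq
    by
      (metis DiffD1 DiffD2 Diff_subset insertI1 range_subsetD)
  \<comment> \<open>The separating pairs later force the indices to infinity: a sequence tending to
    \<open>\<one>\<close> is eventually in \<open>V j\<close>, hence outside \<open>W j\<close>, for
    each fixed \<open>j\<close>.\<close>
  have "\<exists>V W. openin T V \<and> openin T W \<and> \<one> \<in> V \<and> z k \<in> W \<and> disjnt V W" for k
    using haus z one_closed unfolding Hausdorff_space_def topspace_eq by metis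
  then obtain V W where V: "\<And>k. openin T (V k)" "\<And>k. \<one> \<in> V k"
    and W: "\<And>k. openin T (W k)" "\<And>k. z k \<in> W k" and VW: "\<And>k. disjnt (V k) (W k)"
    by metis
  define E where "E = (\<Union>k. {z k \<otimes> x | x. x \<in> A k \<and> z k \<otimes> x \<in> W k})"
  have E_sub: "E \<subseteq> carrier G"
    unfolding E_def using z A_sub closed by blast
  have "\<one> \<in> T closure_of E"
    unfolding in_closure_of
  proof (intro conjI allI impI)
    show "\<one> \<in> topspace T" using one_closed topspace_eq by simp
    fix S assume "\<one> \<in> S \<and> openin T S"
    then have S: "openin T S" "\<one> \<in> S" by auto
    have "\<forall>\<^sub>F k in sequentially. z k \<in> S"
      using z_lim S by (rule limitinD)
    then obtain k where "z k \<in> S" unfolding eventually_sequentially by blast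
    \<comment> \<open>Since \<open>z k \<otimes> \<one> = z k\<close> lies in
      \<open>S \<inter> W k\<close>, so does the translate of any point of \<open>A k\<close> close
      enough to \<open>\<one>\<close>.\<close>
    define S' where "S' = {x \<in> topspace T. z k \<otimes> x \<in> S \<inter> W k}"
    have "openin T S'"
      unfolding S'_def
      by (rule openin_continuous_map_preimage[OF continuous_map_left_mult[OF z(1)]]) (use S W in auto)
    moreover have "\<one> \<in> S'"
      using \<open>z k \<in> S\<close> W z identity one_closed by (simp add: S'_def topspace_eq)
    ultimately obtain x where "x \<in> A k" "x \<in> S'"
      using A_cl[of k] unfolding in_closure_of by blast
    then show "\<exists>y. y \<in> E \<and> y \<in> S"
      unfolding E_def S'_def by blast
  qed
  then obtain s where s: "range s \<subseteq> E" and s_lim: "limitin T s \<one> sequentially"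
    using FU E_sub unfolding Frechet_Urysohn_space_def topspace_eq by blast
  have "\<forall>i. \<exists>k x. s i = z k \<otimes> x \<and> x \<in> A k \<and> s i \<in> W k"
    using s unfolding E_def by fastforce
  then obtain k a where ka: "\<And>i. s i = z (k i) \<otimes> a i" "\<And>i. a i \<in> A (k i)" "\<And>i. s i \<in> W (k i)"
    by metis
  have k_lim: "filterlim k at_top sequentially"
    unfolding filterlim_at_top
  proof
    fix K :: nat
    have "\<forall>\<^sub>F i in sequentially. s i \<in> V j" for j
      using s_lim V by (rule limitinD)
    then have "\<forall>\<^sub>F i in sequentially. \<forall>j\<in>{..<K}. s i \<in> V j"
      by (simp add: eventually_ball_finite)
    then show "\<forall>\<^sub>F i in sequentially. K \<le> k i"
    proof (rule eventually_mono)
      fix i assume "\<forall>j\<in>{..<K}. s i \<in> V j"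
      then show "K \<le> k i"
        using ka(3)[of i] VW[of "k i"] by (force simp: disjnt_iff not_le)
    qed
  qed
  have "limitin T (\<lambda>i. z (k i)) \<one> sequentially"
    using z_lim k_lim unfolding limitin_def by (auto intro: eventually_compose_filterlim)
  from limitin_mult[OF limitin_inv[OF this] s_lim]
  have "limitin T (\<lambda>i. inv (z (k i)) \<otimes> s i) \<one> sequentially"
    using identity one_closed by (simp add: inv_one_elem)
  moreover have "inv (z (k i)) \<otimes> s i = a i" for i
    using left_cancel[OF z(1)] ka(1,2)[of i] A_sub by auto
  ultimately have "limitin T a \<one> sequentially" by simp
  then show thesis using that k_lim ka by blast
qed

text \<open>
  For a finite sequence \<open>l\<close> let \<open>D l\<close> be the intersection of all \<open>U \<beta>\<close> with \<open>\<beta>\<close> extending \<open>l\<close>.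
  If no \<open>D (map \<alpha> [0..<k])\<close> were a neighbourhood of \<open>\<one>\<close>, there would be points
  \<open>a i \<notin> U (\<beta> i)\<close> converging to \<open>\<one>\<close> with \<open>\<beta> i\<close> agreeing with \<open>\<alpha>\<close> on longer and longer initial
  segments; the pointwise supremum \<open>\<gamma>\<close> of the \<open>\<beta> i\<close> is then finite and no \<open>a i\<close> lies in \<open>U \<gamma>\<close>.
\<close>
lemma countable_base_one:
  assumes haus: "Hausdorff_space T" and FU: "Frechet_Urysohn_space T"
    and base: "has_omega_omega_base T"
  obtains B where "countable B" "\<And>V. V \<in> B \<Longrightarrow> openin T V \<and> \<one> \<in> V"
    "\<And>S. \<lbrakk>openin T S; \<one> \<in> S\<rbrakk> \<Longrightarrow> \<exists>V\<in>B. V \<subseteq> S"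
proof (cases "openin T {\<one>}")
  \<comment> \<open>An isolated identity is treated apart, since
    \<open>strongly_Frechet_at_one\<close> needs a nontrivial sequence converging to
    \<open>\<one>\<close>.\<close>
  case True
  then show thesis by (intro that[of "{{\<one>}}"]) auto
next
  case False
  obtain U where U_nbhd: "\<And>\<alpha>. \<exists>V. openin T V \<and> \<one> \<in> V \<and> V \<subseteq> U \<alpha>"
    and U_base: "\<And>W. openin T W \<and> \<one> \<in> W \<Longrightarrow> \<exists>\<alpha>. U \<alpha> \<subseteq> W"
    and U_mono: "\<And>\<alpha> \<beta> :: nat \<Rightarrow> nat. \<alpha> \<le> \<beta> \<Longrightarrow> U \<beta> \<subseteq> U \<alpha>"
    using base one_closed unfolding has_omega_omega_base_def topspace_eq by metis
  define D where "D l = \<Inter>{U \<beta> | \<beta>. \<forall>i<length l. \<beta> i = l ! i}" for l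
  have nbhd: "\<exists>k. \<one> \<in> T interior_of D (map \<alpha> [0..<k])" for \<alpha>
  proof (rule ccontr)
    assume no: "\<nexists>k. \<one> \<in> T interior_of D (map \<alpha> [0..<k])"
    define A where "A k = carrier G - D (map \<alpha> [0..<k])" for k
    have "\<one> \<in> T closure_of A k" for k
    proof -
      have "\<one> \<in> carrier G - T interior_of D (map \<alpha> [0..<k])"
        using no one_closed by blast
      then show ?thesis
        by (simp add: A_def closure_of_complement flip: topspace_eq)
    qed
    moreover have "A k \<subseteq> carrier G" for k by (auto simp: A_def)
    ultimately obtain a k where a_lim: "limitin T a \<one> sequentially"
      and k_lim: "filterlim k at_top sequentially" and a: "\<And>i. a i \<in> A (k i)"
      using strongly_Frechet_at_one[OF haus FU False, of A] by blast
    have "\<exists>\<beta>. (\<forall>j<k i. \<beta> j = \<alpha> j) \<and> a i \<notin> U \<beta>" for i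
      using a[of i] by (auto simp: A_def D_def)
    then obtain \<beta> where \<beta>: "\<And>i j. j < k i \<Longrightarrow> \<beta> i j = \<alpha> j" and a_notin: "\<And>i. a i \<notin> U (\<beta> i)"
      by metis
    \<comment> \<open>Once \<open>k i\<close> exceeds \<open>j\<close>, the value
      \<open>\<beta> i j\<close> is frozen at \<open>\<alpha> j\<close>, so only finitely many
      indices contribute other values.\<close>
    have fin: "finite (range (\<lambda>i. \<beta> i j))" for j
    proof -
      obtain N where N: "\<And>i. i \<ge> N \<Longrightarrow> Suc j \<le> k i"
        using k_lim unfolding filterlim_at_top eventually_sequentially by blast
      have "\<beta> i j \<in> insert (\<alpha> j) ((\<lambda>i. \<beta> i j) ` {..<N})" for i
        using \<beta>[of j i] N[of i] by (cases "i < N") auto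
      then have "range (\<lambda>i. \<beta> i j) \<subseteq> insert (\<alpha> j) ((\<lambda>i. \<beta> i j) ` {..<N})" by blast
      then show ?thesis by (rule finite_subset) simp
    qed
    define \<gamma> where "\<gamma> j = Max (range (\<lambda>i. \<beta> i j))" for j
    have "\<beta> i \<le> \<gamma>" for i
      unfolding le_fun_def \<gamma>_def using fin by (auto intro: Max_ge)
    then have "a i \<notin> U \<gamma>" for i
      using U_mono a_notin by blast
    moreover obtain V where V: "openin T V" "\<one> \<in> V" "V \<subseteq> U \<gamma>"
      using U_nbhd by blast
    ultimately have "a i \<notin> V" for i by blast
    moreover have "\<forall>\<^sub>F i in sequentially. a i \<in> V"
      using a_lim V(1,2) by (rule limitinD)
    ultimately show False by simp
  qed
  let ?B = "{T interior_of D l | l. \<one> \<in> T interior_of D l}"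
  show thesis
  proof (rule that[of ?B])
    have "?B \<subseteq> range (\<lambda>l. T interior_of D l)" by blast
    then show "countable ?B" by (rule countable_subset) simp
    show "openin T V \<and> \<one> \<in> V" if "V \<in> ?B" for V using that by auto
    show "\<exists>V\<in>?B. V \<subseteq> S" if S: "openin T S" "\<one> \<in> S" for S
    proof -
      \<comment> \<open>\<open>\<alpha>\<close> extends each of its own initial segments, so
        \<open>U \<alpha>\<close> is one of the sets intersected in \<open>D\<close>.\<close>
      obtain \<alpha> where \<alpha>: "U \<alpha> \<subseteq> S" using U_base S by blast
      obtain k where k: "\<one> \<in> T interior_of D (map \<alpha> [0..<k])" using nbhd by blast
      have "D (map \<alpha> [0..<k]) \<subseteq> U \<alpha>" unfolding D_def by auto
      then have "T interior_of D (map \<alpha> [0..<k]) \<subseteq> S"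
        by (meson \<alpha> interior_of_subset order_trans)
      then show ?thesis using k by blast
    qed
  qed
qed

end

section \<open>Metrizable spaces satisfy both conditions\<close>

lemma metrizable_imp_has_omega_omega_base:
  assumes "metrizable_space X"
  shows "has_omega_omega_base X"
proof -
  obtain M d where "Metric_space M d" and X: "X = Metric_space.mtopology M d"
    using assms unfolding metrizable_space_def by blast
  then interpret Metric_space M d by simp
  show ?thesis
    unfolding has_omega_omega_base_def
  proof
    fix x assume "x \<in> topspace X"
    then have x: "x \<in> M" by (simp add: X)
    \<comment> \<open>Only the value at 0 selects the radius: a pointwise larger index has a larger
      value there, hence a smaller ball.\<close>
    let ?U = "\<lambda>\<alpha> :: nat \<Rightarrow> nat. mball x (inverse (Suc (\<alpha> 0)))"
    have "?U \<alpha> \<subseteq> topspace X \<and> (\<exists>V. openin X V \<and> x \<in> V \<and> V \<subseteq> ?U \<alpha>)" for \<alpha>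
      using x by (auto simp: X intro!: exI[of _ "?U \<alpha>"])
    moreover have "\<exists>\<alpha>. ?U \<alpha> \<subseteq> W" if W: "openin X W" "x \<in> W" for W
    proof -
      obtain r where r: "r > 0" "mball x r \<subseteq> W"
        using W unfolding X openin_mtopology by blast
      obtain n where "inverse (real (Suc n)) < r"
        using reals_Archimedean[OF r(1)] by blast
      then have "?U (\<lambda>_. n) \<subseteq> W" using r by auto
      then show ?thesis by (intro exI[of _ "\<lambda>_. n"])
    qed
    moreover have "?U \<beta> \<subseteq> ?U \<alpha>" if "\<alpha> \<le> \<beta>" for \<alpha> \<beta>
      using that by (intro mball_subset_concentric) (auto simp: le_fun_def)
    ultimately show "\<exists>U. (\<forall>\<alpha>. U \<alpha> \<subseteq> topspace X \<and> (\<exists>V. openin X V \<and> x \<in> V \<and> V \<subseteq> U \<alpha>)) \<and>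
        (\<forall>W. openin X W \<and> x \<in> W \<longrightarrow> (\<exists>\<alpha>. U \<alpha> \<subseteq> W)) \<and>
        (\<forall>\<alpha> \<beta> :: nat \<Rightarrow> nat. \<alpha> \<le> \<beta> \<longrightarrow> U \<beta> \<subseteq> U \<alpha>)"
      by (intro exI[of _ ?U]) blast
  qed
qed

lemma metrizable_imp_Frechet_Urysohn_space:
  assumes "metrizable_space X"
  shows "Frechet_Urysohn_space X"
proof -
  obtain M d where "Metric_space M d" and X: "X = Metric_space.mtopology M d"
    using assms unfolding metrizable_space_def by blast
  then interpret Metric_space M d by simp
  show ?thesis
    unfolding Frechet_Urysohn_space_def X closure_of_sequentially by blast
qed

theorem corollary3p6:
  fixes G :: "('a, 'b) monoid_scheme" and T :: "'a topology"
  assumes "topological_gyrogroup G T"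
    and "Hausdorff_space T"
  shows "metrizable_space T \<longleftrightarrow> has_omega_omega_base T \<and> Frechet_Urysohn_space T"
proof
  assume "metrizable_space T"
  then show "has_omega_omega_base T \<and> Frechet_Urysohn_space T"
    by (simp add: metrizable_imp_has_omega_omega_base metrizable_imp_Frechet_Urysohn_space)
next
  assume "has_omega_omega_base T \<and> Frechet_Urysohn_space T"
  then have base: "has_omega_omega_base T" and FU: "Frechet_Urysohn_space T" by auto
  interpret topological_gyrogroup G T by (rule assms)
  obtain B where "countable B" "\<And>V. V \<in> B \<Longrightarrow> openin T V \<and> \<one>\<^bsub>G\<^esub> \<in> V"
    "\<And>S. \<lbrakk>openin T S; \<one>\<^bsub>G\<^esub> \<in> S\<rbrakk> \<Longrightarrow> \<exists>V\<in>B. V \<subseteq> S"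
    using countable_base_one[OF assms(2) FU base] by blast
  then show "metrizable_space T"
    by (intro metrizable_if_countable_base_one[of B])
      (auto simp: Hausdorff_imp_t1_space assms(2))
qed

end
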